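(* Assume: (a) $A:\mathcal H\rightrightarrows\mathcal H$ is maximally monotone, and there is $\beta>0$ such that for every $x\in\mathcal H$ the map $\xi\mapsto B(x,\xi)$ is $m_x$-measurable and $\beta$-Lipschitz; (b) there is $\theta>0$ such that for every $x\in\mathcal H$ and $m_x$-almost every $\xi\in\Xi$, $\theta\|B(y,\xi)-B(z,\xi)\|^2\le\langle B(y,\xi)-B(z,\xi),y-z\rangle$ for all $y,z\in\mathcal H$; (c) there is $\tau>0$ such that $\mathbb W_1(m_x,m_y)\le\tau\|x-y\|$ for all $x,y\in\mathcal H$; (d) there is $\mu_A>0$ such that $A$ is $\mu_A$-strongly monotone, and $\frac{\beta\tau}{\mu_A}<1$. Then the single-valued mapping $S:\mathcal H\to\mathcal H$ defined by $S(x)=\mathrm{zer}(A+B_{m_x})$ is a strict contraction, and there exists a unique equilibrium point $\bar x\in\mathcal H$ satisfying $0\in A(\bar x)+B_{m_{\bar x}}(\bar x)$.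
   Context: $\mathcal H$ is a real Hilbert space, $\Xi$ a Polish space (with its complete metric), $(m_x)_{x\in\mathcal H}$ a family of probability measures on $\Xi$, $A:\mathcal H\rightrightarrows\mathcal H$ a set-valued operator and $B:\mathcal H\times\Xi\to\mathcal H$ single-valued. For a probability measure $m$ on $\Xi$, $B_m:\mathcal H\to\mathcal H$ is the single-valued operator $B_m(y)=\mathbb E_{\xi\sim m}[B(y,\xi)]$ (expectations are taken to be well defined). For an operator $C$, $\mathrm{zer}(C)=\{u\in\mathcal H:0\in C(u)\}$; $S(x)$ denotes the unique element of $\mathrm{zer}(A+B_{m_x})$, where $m_x$ is held fixed. $A$ is $\mu_A$-strongly monotone if $\langle x-y,u-v\rangle\ge\mu_A\|x-y\|^2$ whenever $u\in A(x)$, $v\in A(y)$. $\mathbb W_1(m_1,m_2)=\sup_{h}|\mathbb E_{\xi\sim m_1}[h(\xi)]-\mathbb E_{\eta\sim m_2}[h(\eta)]|$, the supremum over $1$-Lipschitz $h:\Xi\to\mathbb R$. A strict contraction is a map that is Lipschitz with a constant $<1$. *)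

theory Defs
  imports "HOL-Probability.Probability"
begin

section \<open>Set-valued operators\<close>

definition monotone_operator :: "('h::real_inner \<Rightarrow> 'h set) \<Rightarrow> bool" where
  "monotone_operator A \<longleftrightarrow>
     (\<forall>x y. \<forall>u\<in>A x. \<forall>v\<in>A y. inner (x - y) (u - v) \<ge> 0)"

definition maximally_monotone :: "('h::real_inner \<Rightarrow> 'h set) \<Rightarrow> bool" where
  "maximally_monotone A \<longleftrightarrow>
     monotone_operator A \<and>
     (\<forall>C. monotone_operator C \<longrightarrow> (\<forall>x. A x \<subseteq> C x) \<longrightarrow> C = A)"

definition strongly_monotone :: "real \<Rightarrow> ('h::real_inner \<Rightarrow> 'h set) \<Rightarrow> bool" where
  "strongly_monotone \<mu> A \<longleftrightarrow>
     (\<forall>x y. \<forall>u\<in>A x. \<forall>v\<in>A y. inner (x - y) (u - v) \<ge> \<mu> * (norm (x - y))\<^sup>2)"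

definition add_single :: "('h \<Rightarrow> 'h set) \<Rightarrow> ('h \<Rightarrow> 'h) \<Rightarrow> 'h::real_vector \<Rightarrow> 'h set" where
  "add_single A b y = {a + b y |a. a \<in> A y}"

definition zer :: "('h::real_vector \<Rightarrow> 'h set) \<Rightarrow> 'h set" where
  "zer C = {u. 0 \<in> C u}"

definition strict_contraction :: "('a::metric_space \<Rightarrow> 'b::metric_space) \<Rightarrow> bool" where
  "strict_contraction f \<longleftrightarrow> (\<exists>L<1. L-lipschitz_on UNIV f)"


section \<open>Expectations of Hilbert-space valued maps\<close>

text \<open>
  The library's Bochner integral is restricted to second countable target spaces. The Hilbert
  space here need not be separable, so the same definition is repeated without that restriction.
  For Borel measurable \<open>f\<close>, a sequence of simple functions with mean error tending to \<open>0\<close>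
  forces \<open>f\<close> to be almost everywhere separably valued, i.e. strongly measurable.
\<close>

definition has_mean :: "'a measure \<Rightarrow> ('a \<Rightarrow> 'h::real_normed_vector) \<Rightarrow> 'h \<Rightarrow> bool" where
  "has_mean M f e \<longleftrightarrow>
     f \<in> borel_measurable M \<and>
     (\<exists>s. (\<forall>i. Bochner_Integration.simple_bochner_integrable M (s i)) \<and>
          (\<lambda>i. \<integral>\<^sup>+\<xi>. ennreal (norm (f \<xi> - s i \<xi>)) \<partial>M) \<longlonglongrightarrow> 0 \<and>
          (\<lambda>i::nat. Bochner_Integration.simple_bochner_integral M (s i)) \<longlonglongrightarrow> e)"

lemma has_mean_iff_has_bochner_integral:
  fixes f :: "'a \<Rightarrow> 'h::{real_normed_vector, second_countable_topology}"
  shows "has_mean M f e \<longleftrightarrow> has_bochner_integral M f e"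
  unfolding has_mean_def has_bochner_integral.simps by blast

definition mean_exists :: "'a measure \<Rightarrow> ('a \<Rightarrow> 'h::real_normed_vector) \<Rightarrow> bool" where
  "mean_exists M f \<longleftrightarrow> (\<exists>e. has_mean M f e)"

definition mean :: "'a measure \<Rightarrow> ('a \<Rightarrow> 'h::real_normed_vector) \<Rightarrow> 'h" where
  "mean M f = (THE e. has_mean M f e)"

definition mean_operator ::
    "('h \<Rightarrow> 'x \<Rightarrow> 'h::real_normed_vector) \<Rightarrow> 'x measure \<Rightarrow> 'h \<Rightarrow> 'h" where
  "mean_operator B M y = mean M (\<lambda>\<xi>. B y \<xi>)"


section \<open>The Wasserstein-1 distance\<close>

text \<open>
  The supremum runs over the 1-Lipschitz functions for which both expectations are defined, and
  is taken in \<open>[0, \<infinity>]\<close>. For measures with finite first moment these are all the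
  1-Lipschitz functions; see below. Without the integrability condition, the library's value
  \<open>0\<close> for the integral of a non-integrable function would enter the supremum.
\<close>

definition W1 :: "'x::metric_space measure \<Rightarrow> 'x measure \<Rightarrow> ennreal" where
  "W1 M N =
     (SUP h\<in>{h :: 'x \<Rightarrow> real. 1-lipschitz_on UNIV h \<and> integrable M h \<and> integrable N h}.
        ennreal \<bar>(\<integral>\<xi>. h \<xi> \<partial>M) - (\<integral>\<eta>. h \<eta> \<partial>N)\<bar>)"

lemma integrable_lipschitz_if_finite_first_moment:
  fixes h :: "'x::metric_space \<Rightarrow> real"
  assumes "prob_space M" and sets: "sets M = sets borel"
    and mom: "integrable M (\<lambda>\<xi>. dist a \<xi>)" and lip: "1-lipschitz_on UNIV h"
  shows "integrable M h"
proof -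
  interpret prob_space M by fact
  have "continuous_on UNIV h" by (rule lipschitz_on_continuous_on[OF lip])
  then have meas: "h \<in> borel_measurable M"
    using sets measurable_cong_sets borel_measurable_continuous_onI by blast
  have "integrable M (\<lambda>\<xi>. \<bar>h a\<bar> + dist a \<xi>)" using mom by simp
  moreover have "AE \<xi> in M. norm (h \<xi>) \<le> norm (\<bar>h a\<bar> + dist a \<xi>)"
  proof (rule AE_I2)
    fix \<xi>
    have "\<bar>h a - h \<xi>\<bar> \<le> dist a \<xi>" using lipschitz_onD[OF lip, of a \<xi>] by (simp add: dist_real_def)
    then show "norm (h \<xi>) \<le> norm (\<bar>h a\<bar> + dist a \<xi>)" by simp
  qed
  ultimately show ?thesis using meas Bochner_Integration.integrable_bound by blast
qed


section \<open>The solution map\<close>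

text \<open>Only meaningful where \<open>zer\<close> of the sum is a singleton.\<close>

definition solution_map ::
    "('h \<Rightarrow> 'h set) \<Rightarrow> ('h \<Rightarrow> 'x \<Rightarrow> 'h) \<Rightarrow> ('h \<Rightarrow> 'x measure) \<Rightarrow> 'h \<Rightarrow> 'h::real_normed_vector" where
  "solution_map A B m x = (THE u. u \<in> zer (add_single A (mean_operator B (m x))))"

end

theory Submission
  imports Defs
begin

text \<open>
  The theorem rests on three facts. First, if \<open>A\<close> is maximally and strongly monotone and \<open>b\<close> is
  cocoercive, then \<open>A + b\<close> has a zero, the fixed point of the forward-backward map
  \<open>(I + \<theta> A)\<inverse> (I - \<theta> b)\<close> (\<open>zer_strongly_monotone_add_cocoercive_nonempty\<close>). The resolvent
  \<open>(I + \<theta> A)\<inverse>\<close> is defined everywhere by Minty's theorem (\<open>minty_surjectivity\<close>), which is obtained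
  by minimizing the Fitzpatrick function plus half the squared norm; that sum is strongly convex,
  so its minimizer exists by completeness alone. The averaged operator \<open>B\<^sub>m\<close> is cocoercive since
  \<open>B\<close> is so almost surely (\<open>mean_operator_cocoercive\<close>); hence \<open>S (x)\<close> exists.

  Second, strong monotonicity of \<open>A\<close> and monotonicity of \<open>B\<^sub>m\<close> for \<open>m = m\<^sub>x\<close> bound
  \<open>\<mu> \<parallel>S (x) - S (y)\<parallel>\<^sup>2\<close> by the inner product of \<open>S (x) - S (y)\<close> with the difference of the
  operators for \<open>m\<^sub>y\<close> and \<open>m\<^sub>x\<close> at the single point \<open>S (y)\<close> (\<open>zer_perturbation\<close>). With \<open>m\<^sub>x\<close> on
  both sides this also gives uniqueness of the zero.

  Third, that inner product is a difference of expectations of one real function, which is Lipschitz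
  with constant \<open>\<beta> \<parallel>S (x) - S (y)\<parallel>\<close>, so it is at most \<open>\<beta> \<tau> \<parallel>x - y\<parallel> \<parallel>S (x) - S (y)\<parallel>\<close>
  (\<open>mean_operator_diff_le_W1\<close>). Therefore \<open>S\<close> has Lipschitz constant \<open>\<beta> \<tau> / \<mu> < 1\<close>. Equilibrium
  points are exactly the fixed points of \<open>S\<close>, and Banach's theorem gives exactly one.
\<close>

section \<open>Surjectivity for maximally monotone operators\<close>

text \<open>
  A point monotonically related to the whole graph can be added to the graph without destroying
  monotonicity, so maximality puts it there already.
\<close>

lemma maximally_monotone_memI:
  assumes "maximally_monotone A"
    and "\<And>y v. v \<in> A y \<Longrightarrow> inner (x - y) (u - v) \<ge> 0"
  shows "u \<in> A x"
proof -
  let ?C = "A(x := insert u (A x))"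
  have sym: "inner (y - x) (v - u) \<ge> 0" if "v \<in> A y" for y v
    using assms(2)[OF that] by (metis inner_minus_left inner_minus_right minus_diff_eq minus_minus)
  have "monotone_operator A" using assms(1) by (simp add: maximally_monotone_def)
  then have "monotone_operator ?C"
    unfolding monotone_operator_def using assms(2) sym by (auto split: if_splits)
  moreover have "\<forall>z. A z \<subseteq> ?C z" by auto
  ultimately have "?C = A" using assms(1) unfolding maximally_monotone_def by blast
  then show ?thesis by (metis fun_upd_same insertI1)
qed

lemma maximally_monotone_graph_nonempty:
  assumes "maximally_monotone A"
  obtains y v where "v \<in> A y"
  using maximally_monotone_memI[OF assms, of 0 0] by blast

text \<open>
  This reduces the resolvent equation \<open>z \<in> x + \<gamma> A x\<close> to the normalized inclusion
  \<open>- x \<in> \<gamma> A x - z\<close>, which has the form \<open>- x \<in> D x\<close> for a maximally monotone \<open>D\<close>.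
\<close>

lemma maximally_monotone_scale_translate:
  fixes A :: "'h::real_inner \<Rightarrow> 'h set"
  assumes max: "maximally_monotone A" and lam: "\<gamma> > 0"
  shows "maximally_monotone (\<lambda>x. (\<lambda>u. \<gamma> *\<^sub>R u - z) ` A x)" (is "maximally_monotone ?D")
proof -
  have monA: "monotone_operator A" using max by (simp add: maximally_monotone_def)
  have "monotone_operator ?D"
    unfolding monotone_operator_def
  proof (intro allI ballI)
    fix x y u v assume "u \<in> ?D x" "v \<in> ?D y"
    then obtain u' v' where uv: "u' \<in> A x" "v' \<in> A y" "u = \<gamma> *\<^sub>R u' - z" "v = \<gamma> *\<^sub>R v' - z" by auto
    then have "u - v = \<gamma> *\<^sub>R (u' - v')" by (simp add: scaleR_diff_right)
    then have "inner (x - y) (u - v) = \<gamma> * inner (x - y) (u' - v')" by simp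
    then show "inner (x - y) (u - v) \<ge> 0"
      using uv monA lam by (simp add: monotone_operator_def)
  qed
  moreover have "C = ?D" if mC: "monotone_operator C" and sub: "\<forall>x. ?D x \<subseteq> C x" for C
  proof -
    have "u \<in> ?D x" if u: "u \<in> C x" for x u
    proof -
      have "(1 / \<gamma>) *\<^sub>R (u + z) \<in> A x"
      proof (rule maximally_monotone_memI[OF max])
        fix y v assume "v \<in> A y"
        then have "\<gamma> *\<^sub>R v - z \<in> C y" using sub by auto
        then have "inner (x - y) (u - (\<gamma> *\<^sub>R v - z)) \<ge> 0"
          using mC u by (simp add: monotone_operator_def)
        moreover have "(1 / \<gamma>) *\<^sub>R (u + z) - v = (1 / \<gamma>) *\<^sub>R (u - (\<gamma> *\<^sub>R v - z))"
          using lam by (simp add: algebra_simps)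
        ultimately show "inner (x - y) ((1 / \<gamma>) *\<^sub>R (u + z) - v) \<ge> 0"
          using lam by simp
      qed
      then show ?thesis using lam by (auto intro!: image_eqI)
    qed
    then show ?thesis using sub by blast
  qed
  ultimately show ?thesis unfolding maximally_monotone_def by blast
qed

text \<open>
  Strong convexity replaces weak compactness: the parallelogram law turns a minimizing sequence
  of \<open>t + \<parallel>p\<parallel>\<^sup>2 / 2\<close> into a Cauchy sequence, so completeness alone yields a minimizer. Stating
  this for a closed convex set \<open>E\<close>, meant to be an epigraph, admits convex functions with value
  \<open>\<infinity>\<close>. The conclusion is the variational inequality of the minimizer \<open>(p, t)\<close>; it says
  that \<open>- p\<close> is a subgradient at \<open>p\<close> of the function with epigraph \<open>E\<close>.
\<close>

lemma regularized_minimum_on_epigraph: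
  fixes E :: "('a::{real_inner, complete_space} \<times> real) set"
  assumes conv: "convex E" and clo: "closed E" and ne: "E \<noteq> {}"
    and bdd: "\<And>p t. (p, t) \<in> E \<Longrightarrow> c \<le> t + (norm p)\<^sup>2 / 2"
  obtains p t where "(p, t) \<in> E"
    "\<And>q s. (q, s) \<in> E \<Longrightarrow> t + (norm p)\<^sup>2 \<le> s + inner p q"
proof -
  define \<phi> :: "'a \<times> real \<Rightarrow> real" where "\<phi> = (\<lambda>e. snd e + (norm (fst e))\<^sup>2 / 2)"
  define d where "d = Inf (\<phi> ` E)"
  have bb: "bdd_below (\<phi> ` E)"
    using bdd by (auto simp: \<phi>_def intro!: bdd_belowI2[where m=c])
  have dle: "d \<le> \<phi> e" if "e \<in> E" for e
    unfolding d_def using bb that by (intro cInf_lower) auto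
  have "\<exists>e\<in>E. \<phi> e < d + 1 / (real n + 1)" for n
  proof -
    have "\<exists>y\<in>\<phi> ` E. y < d + 1 / (real n + 1)"
      unfolding d_def using ne by (intro cInf_lessD) auto
    then show ?thesis by auto
  qed
  then obtain e where eE: "\<And>n. e n \<in> E" and e: "\<And>n. \<phi> (e n) < d + 1 / (real n + 1)"
    by metis
  have par: "(norm (fst a - fst b))\<^sup>2 \<le> 4 * (\<phi> a - d) + 4 * (\<phi> b - d)" if "a \<in> E" "b \<in> E" for a b
  proof -
    let ?m = "(1/2) *\<^sub>R a + (1/2) *\<^sub>R b"
    have "?m \<in> E" using conv that by (intro convexD) auto
    then have "d \<le> \<phi> ?m" by (rule dle)
    moreover have "\<phi> ?m = (\<phi> a + \<phi> b) / 2 - (norm (fst a - fst b))\<^sup>2 / 8"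
      unfolding \<phi>_def power2_norm_eq_inner
      by (simp add: inner_add inner_diff inner_commute field_simps)
    ultimately show ?thesis by (simp add: field_simps)
  qed
  have "Cauchy (\<lambda>n. fst (e n))"
  proof (rule CauchyI)
    fix r :: real assume r: "r > 0"
    obtain N where N: "8 / r\<^sup>2 < real N" using reals_Archimedean2 by blast
    have "norm (fst (e m) - fst (e n)) < r" if "m \<ge> N" "n \<ge> N" for m n
    proof -
      have k: "\<phi> (e k) - d < r\<^sup>2 / 8" if "k \<ge> N" for k
      proof -
        have "8 / r\<^sup>2 < real k + 1" using N that by linarith
        then have "1 / (real k + 1) < r\<^sup>2 / 8" using r by (simp add: field_simps)
        then show ?thesis using e[of k] by simp
      qed
      have "(norm (fst (e m) - fst (e n)))\<^sup>2 < r\<^sup>2"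
        using par[OF eE eE, of m n] k[OF that(1)] k[OF that(2)] by simp
      then show ?thesis using r by (simp add: power_less_imp_less_base)
    qed
    then show "\<exists>M. \<forall>m\<ge>M. \<forall>n\<ge>M. norm (fst (e m) - fst (e n)) < r" by blast
  qed
  then obtain p where p: "(\<lambda>n. fst (e n)) \<longlonglongrightarrow> p"
    using Cauchy_convergent convergent_def by blast
  have "(\<lambda>n. \<phi> (e n)) \<longlonglongrightarrow> d"
  proof (rule tendsto_sandwich)
    show "\<forall>\<^sub>F n in sequentially. d \<le> \<phi> (e n)" using dle eE by simp
    show "\<forall>\<^sub>F n in sequentially. \<phi> (e n) \<le> d + 1 / (real n + 1)"
      using e by (simp add: less_imp_le)
    have "(\<lambda>n. d + 1 / (real n + 1)) \<longlonglongrightarrow> d + 0"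
      using LIMSEQ_inverse_real_of_nat by (intro tendsto_intros) (simp add: inverse_eq_divide add.commute)
    then show "(\<lambda>n. d + 1 / (real n + 1)) \<longlonglongrightarrow> d" by simp
  qed simp
  then have "(\<lambda>n. \<phi> (e n) - (norm (fst (e n)))\<^sup>2 / 2) \<longlonglongrightarrow> d - (norm p)\<^sup>2 / 2"
    by (intro tendsto_intros p) auto
  then have t: "(\<lambda>n. snd (e n)) \<longlonglongrightarrow> d - (norm p)\<^sup>2 / 2" by (simp add: \<phi>_def)
  define t where "t = d - (norm p)\<^sup>2 / 2"
  have "(\<lambda>n. (fst (e n), snd (e n))) \<longlonglongrightarrow> (p, t)"
    unfolding t_def by (intro tendsto_Pair p t)
  then have pt: "(p, t) \<in> E"
    using closed_sequentially[OF clo eE] by simp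
  have min: "t + (norm p)\<^sup>2 / 2 \<le> \<phi> e" if "e \<in> E" for e
    using dle[OF that] by (simp add: t_def)
  have "t + (norm p)\<^sup>2 \<le> s + inner p q" if qs: "(q, s) \<in> E" for q s
  proof -
    \<comment> \<open>Minimality along the segment from \<open>(p, t)\<close> to \<open>(q, s)\<close>, divided by the step length \<open>r\<close>;
      the quadratic term vanishes as \<open>r\<close> tends to \<open>0\<close>.\<close>
    let ?a = "s - t + inner p (q - p)" and ?b = "(norm (q - p))\<^sup>2 / 2"
    have "0 \<le> ?a + r * ?b" if r: "0 < r" "r < 1" for r
    proof -
      have "(1 - r) *\<^sub>R (p, t) + r *\<^sub>R (q, s) \<in> E"
        using conv pt qs r by (intro convexD) auto
      from min[OF this] have "0 \<le> r * (?a + r * ?b)"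
        unfolding \<phi>_def power2_norm_eq_inner
        by (simp add: inner_add inner_diff inner_commute algebra_simps)
          (simp add: field_simps)
      then show ?thesis using r by (simp add: zero_le_mult_iff)
    qed
    then have "\<forall>\<^sub>F r in at_right 0. 0 \<le> ?a + r * ?b"
      by (auto simp: eventually_at_right_field intro!: exI[of _ 1])
    moreover have "((\<lambda>r. ?a + r * ?b) \<longlongrightarrow> ?a + 0 * ?b) (at_right 0)"
      by (intro tendsto_intros)
    ultimately have "0 \<le> ?a + 0 * ?b"
      by (intro tendsto_lowerbound[of _ _ "at_right (0::real)"]) auto
    then show ?thesis by (simp add: inner_diff_right power2_norm_eq_inner)
  qed
  with pt show thesis using that by blast
qed

text \<open>
  Minty's theorem at the point \<open>0\<close>. The set \<open>E\<close> is the epigraph of the Fitzpatrick function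
  \<open>F (x, u) = (SUP (y, v). \<langle>x, v\<rangle> + \<langle>y, u\<rangle> - \<langle>y, v\<rangle>)\<close>, the supremum over the graph of \<open>A\<close>.
  Maximality gives \<open>F (x, u) \<ge> \<langle>x, u\<rangle>\<close>, hence \<open>F (x, u) + \<parallel>(x, u)\<parallel>\<^sup>2 / 2 \<ge> \<parallel>x + u\<parallel>\<^sup>2 / 2\<close>, which is
  bounded below. On the graph \<open>F (y, v) = \<langle>y, v\<rangle>\<close>, so the variational inequality at a minimizer
  \<open>(x, u)\<close> reads \<open>\<langle>y + u, v + x\<rangle> \<ge> \<parallel>x + u\<parallel>\<^sup>2\<close> for all \<open>(y, v)\<close> in the graph. By maximality
  \<open>(- u, - x)\<close> lies in the graph, and inserting that point forces \<open>u = - x\<close>.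
\<close>

lemma maximally_monotone_neg_fixed_point:
  fixes A :: "'h::{real_inner, complete_space} \<Rightarrow> 'h set"
  assumes max: "maximally_monotone A"
  shows "\<exists>x. - x \<in> A x"
proof -
  have mon: "inner (x - y) (u - v) \<ge> 0" if "u \<in> A x" "v \<in> A y" for x y u v
    using max that by (simp add: maximally_monotone_def monotone_operator_def)
  define E :: "(('h \<times> 'h) \<times> real) set" where
    "E = (\<Inter>(y, v)\<in>{(y, v). v \<in> A y}.
            {e. inner (fst (fst e)) v + inner y (snd (fst e)) - inner y v \<le> snd e})"
  have Eiff: "((x, u), t) \<in> E \<longleftrightarrow>
      (\<forall>y v. v \<in> A y \<longrightarrow> inner x v + inner y u - inner y v \<le> t)" for x u t
    by (auto simp: E_def)
  have graph: "((y, v), inner y v) \<in> E" if "v \<in> A y" for y v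
    unfolding Eiff using mon[OF that] by (fastforce simp: inner_diff inner_commute)
  have conv: "convex E"
  proof (rule convexI)
    fix e f :: "('h \<times> 'h) \<times> real" and a b :: real
    assume e: "e \<in> E" and f: "f \<in> E" and ab: "0 \<le> a" "0 \<le> b" "a + b = 1"
    obtain x u t x' u' t' where ef: "e = ((x, u), t)" "f = ((x', u'), t')"
      by (metis surj_pair)
    have "inner (a *\<^sub>R x + b *\<^sub>R x') v + inner y (a *\<^sub>R u + b *\<^sub>R u') - inner y v \<le> a * t + b * t'"
      if v: "v \<in> A y" for y v
    proof -
      have "inner x v + inner y u - inner y v \<le> t" "inner x' v + inner y u' - inner y v \<le> t'"
        using e f v by (auto simp: ef Eiff)
      then have "a * (inner x v + inner y u - inner y v) + b * (inner x' v + inner y u' - inner y v)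
          \<le> a * t + b * t'"
        using ab by (intro add_mono mult_left_mono) auto
      moreover have "a * inner y v + b * inner y v = inner y v"
        using ab(3) by (metis distrib_right mult_1)
      ultimately show ?thesis by (simp add: inner_add algebra_simps)
    qed
    then show "a *\<^sub>R e + b *\<^sub>R f \<in> E" by (simp add: ef Eiff)
  qed
  have clo: "closed E"
    unfolding E_def by (auto intro!: closed_INT closed_Collect_le continuous_intros)
  have ne: "E \<noteq> {}"
    using maximally_monotone_graph_nonempty[OF max] graph by blast
  have fitz: "inner x u \<le> t" if xu: "((x, u), t) \<in> E" for x u t
  proof (cases "u \<in> A x")
    case True
    then show ?thesis using xu by (force simp: Eiff)
  next
    case False
    then obtain y v where yv: "v \<in> A y" "inner (x - y) (u - v) < 0"
      using maximally_monotone_memI[OF max] by (meson not_le)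
    have "inner x v + inner y u - inner y v \<le> t" using xu yv(1) by (simp add: Eiff)
    then show ?thesis using yv(2) by (simp add: inner_diff)
  qed
  have bdd: "0 \<le> t + (norm p)\<^sup>2 / 2" if "(p, t) \<in> E" for p t
  proof -
    obtain x u where p: "p = (x, u)" by fastforce
    have "0 \<le> inner (x + u) (x + u) / 2" by simp
    also have "\<dots> = inner x u + (norm p)\<^sup>2 / 2"
      by (simp add: p power2_norm_eq_inner inner_add inner_commute)
    also have "\<dots> \<le> t + (norm p)\<^sup>2 / 2" using fitz that by (simp add: p)
    finally show ?thesis .
  qed
  obtain p t where pt: "(p, t) \<in> E"
    and var: "\<And>q s. (q, s) \<in> E \<Longrightarrow> t + (norm p)\<^sup>2 \<le> s + inner p q"
    using regularized_minimum_on_epigraph[OF conv clo ne bdd] by metis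
  obtain x u where p: "p = (x, u)" by fastforce
  have key: "inner (x + u) (x + u) \<le> inner (y + u) (v + x)" if "v \<in> A y" for y v
  proof -
    have "t + (norm p)\<^sup>2 \<le> inner y v + inner p (y, v)" using var[OF graph[OF that]] .
    moreover have "inner x u \<le> t" using fitz pt by (simp add: p)
    ultimately show ?thesis
      by (simp add: p power2_norm_eq_inner inner_add inner_commute)
  qed
  have mem: "- x \<in> A (- u)"
  proof (rule maximally_monotone_memI[OF max])
    fix y v assume "v \<in> A y"
    then have "0 \<le> inner (y + u) (v + x)" using key inner_ge_zero order_trans by blast
    then show "0 \<le> inner (- u - y) (- x - v)"
      by (simp add: inner_diff inner_add inner_commute)
  qed
  from key[OF this] have "inner (x + u) (x + u) \<le> 0" by simp
  then have "x + u = 0" by (metis inner_gt_zero_iff not_le)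
  then have "- u = x" by (simp add: add_eq_0_iff)
  with mem show ?thesis by auto
qed

theorem minty_surjectivity:
  fixes A :: "'h::{real_inner, complete_space} \<Rightarrow> 'h set"
  assumes "maximally_monotone A" and "\<gamma> > 0"
  shows "\<exists>x. \<exists>a\<in>A x. x + \<gamma> *\<^sub>R a = z"
proof -
  obtain x where "- x \<in> (\<lambda>u. \<gamma> *\<^sub>R u - z) ` A x"
    using maximally_monotone_neg_fixed_point[OF maximally_monotone_scale_translate[OF assms]] by blast
  then obtain a where "a \<in> A x" "- x = \<gamma> *\<^sub>R a - z" by auto
  then have "x + \<gamma> *\<^sub>R a = z" by (simp add: algebra_simps)
  with \<open>a \<in> A x\<close> show ?thesis by blast
qed


section \<open>Zeros of a strongly monotone plus a cocoercive operator\<close>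

lemma zer_add_single_iff: "u \<in> zer (add_single A b) \<longleftrightarrow> - b u \<in> A u"
proof -
  have "0 = a + b u \<longleftrightarrow> a = - b u" for a by (metis eq_neg_iff_add_eq_0)
  then show ?thesis by (simp add: zer_def add_single_def)
qed

text \<open>
  Zeros of \<open>A + b\<close> are the fixed points of the forward-backward map, the composition of the
  resolvent \<open>(I + \<theta> A)\<inverse>\<close> with \<open>I - \<theta> b\<close>. Cocoercivity makes the inner map nonexpansive,
  strong monotonicity makes the resolvent a contraction with constant \<open>1 / (1 + \<theta> \<mu>)\<close>, and
  Minty's theorem makes it defined everywhere.
\<close>

lemma zer_strongly_monotone_add_cocoercive_nonempty:
  fixes A :: "'h::{real_inner, complete_space} \<Rightarrow> 'h set"
  assumes max: "maximally_monotone A" and str: "strongly_monotone \<mu> A" and mu: "\<mu> > 0"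
    and th: "\<theta> > 0"
    and coco: "\<And>y z. \<theta> * (norm (b y - b z))\<^sup>2 \<le> inner (b y - b z) (y - z)"
  shows "\<exists>u. u \<in> zer (add_single A b)"
proof -
  have "\<forall>w. \<exists>x. \<exists>a\<in>A x. x + \<theta> *\<^sub>R a = w" using minty_surjectivity[OF max th] by blast
  then obtain R a where a: "\<And>w. a w \<in> A (R w)" and R: "\<And>w. R w + \<theta> *\<^sub>R a w = w"
    by metis
  have Rc: "norm (R w - R w') \<le> 1 / (1 + \<theta> * \<mu>) * norm (w - w')" for w w'
  proof -
    have "\<mu> * (norm (R w - R w'))\<^sup>2 \<le> inner (R w - R w') (a w - a w')"
      using str a by (simp add: strongly_monotone_def)
    then have "\<theta> * (\<mu> * (norm (R w - R w'))\<^sup>2) \<le> \<theta> * inner (R w - R w') (a w - a w')"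
      using th by simp
    then have "(1 + \<theta> * \<mu>) * (norm (R w - R w'))\<^sup>2
        \<le> (norm (R w - R w'))\<^sup>2 + \<theta> * inner (R w - R w') (a w - a w')"
      by (simp add: distrib_right)
    also have "\<dots> = inner (R w - R w') ((R w + \<theta> *\<^sub>R a w) - (R w' + \<theta> *\<^sub>R a w'))"
      by (simp add: power2_norm_eq_inner inner_diff inner_add algebra_simps)
    also have "\<dots> \<le> norm (R w - R w') * norm (w - w')"
      unfolding R by (rule norm_cauchy_schwarz)
    finally have "norm (R w - R w') * ((1 + \<theta> * \<mu>) * norm (R w - R w'))
        \<le> norm (R w - R w') * norm (w - w')"
      by (simp add: power2_eq_square mult.left_commute)
    then have "(1 + \<theta> * \<mu>) * norm (R w - R w') \<le> norm (w - w')"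
      by (cases "R w = R w'") (simp_all add: mult_le_cancel_left_pos)
    moreover have "1 + \<theta> * \<mu> > 0" using th mu by (simp add: add_pos_pos)
    ultimately show ?thesis by (simp add: field_simps)
  qed
  define G where "G y = y - \<theta> *\<^sub>R b y" for y
  have G: "norm (G y - G z) \<le> norm (y - z)" for y z
  proof -
    have "(norm (G y - G z))\<^sup>2 = (norm (y - z))\<^sup>2
        - 2 * \<theta> * inner (b y - b z) (y - z) + \<theta> * (\<theta> * (norm (b y - b z))\<^sup>2)"
      unfolding G_def power2_norm_eq_inner
      by (simp add: inner_diff inner_commute algebra_simps)
    also have "\<dots> \<le> (norm (y - z))\<^sup>2 - \<theta> * inner (b y - b z) (y - z)"
      using mult_left_mono[OF coco[of y z], of \<theta>] th by simp
    also have "\<dots> \<le> (norm (y - z))\<^sup>2"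
      using coco[of y z] th by (smt (verit) mult_nonneg_nonneg zero_le_power2)
    finally show ?thesis by (rule power2_le_imp_le) simp
  qed
  have "\<theta> * \<mu> > 0" using th mu by simp
  then have c: "0 \<le> 1 / (1 + \<theta> * \<mu>)" "1 / (1 + \<theta> * \<mu>) < 1" by simp_all
  have "norm (R (G x) - R (G y)) \<le> 1 / (1 + \<theta> * \<mu>) * norm (x - y)" for x y
    using order_trans[OF Rc mult_left_mono[OF G c(1)]] .
  then have "\<exists>!x. R (G x) = x"
    unfolding dist_norm[symmetric] using banach_fix_type[OF c, of "R \<circ> G"] by simp
  then obtain x where x: "R (G x) = x" by blast
  have "\<theta> *\<^sub>R a (G x) = \<theta> *\<^sub>R (- b x)" using R[of "G x"] x by (simp add: G_def)
  then have "a (G x) = - b x" using th by (metis real_vector.scale_cancel_left less_irrefl)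
  then have "- b x \<in> A x" using a[of "G x"] x by simp
  then show ?thesis using zer_add_single_iff by blast
qed

text \<open>
  Monotonicity of the first perturbation absorbs the displacement between the two zeros, which
  leaves only the difference of the perturbations at the single point \<open>v\<close>. With \<open>b = b'\<close> this is
  uniqueness of the zero.
\<close>

lemma zer_perturbation:
  fixes A :: "'h::real_inner \<Rightarrow> 'h set"
  assumes str: "strongly_monotone \<mu> A"
    and mon: "\<And>y z. 0 \<le> inner (b y - b z) (y - z)"
    and u: "u \<in> zer (add_single A b)" and v: "v \<in> zer (add_single A b')"
  shows "\<mu> * (norm (u - v))\<^sup>2 \<le> inner (b' v - b v) (u - v)"
proof -
  have "\<mu> * (norm (u - v))\<^sup>2 \<le> inner (u - v) (- b u - (- b' v))"
    using str u v unfolding strongly_monotone_def zer_add_single_iff by blast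
  also have "\<dots> = inner (b' v - b v) (u - v) - inner (b u - b v) (u - v)"
    by (simp add: inner_diff inner_commute)
  finally show ?thesis using mon[of u v] by linarith
qed


section \<open>Expectations tested against vectors\<close>

text \<open>
  Testing against a vector turns an expectation in a possibly nonseparable space into an ordinary
  real integral. Uniqueness of the expectation, cocoercivity of \<open>B\<^sub>m\<close> and the Wasserstein estimate
  are all obtained through such scalar integrals.
\<close>

lemma has_mean_inner:
  fixes f :: "'a \<Rightarrow> 'h::real_inner"
  assumes "has_mean M f e"
  shows "has_bochner_integral M (\<lambda>\<xi>. inner (f \<xi>) w) (inner e w)"
proof -
  from assms obtain s where f: "f \<in> borel_measurable M"
    and s: "\<And>i. Bochner_Integration.simple_bochner_integrable M (s i)"
    and fs: "(\<lambda>i. \<integral>\<^sup>+\<xi>. ennreal (norm (f \<xi> - s i \<xi>)) \<partial>M) \<longlonglongrightarrow> 0"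
    and se: "(\<lambda>i. Bochner_Integration.simple_bochner_integral M (s i)) \<longlonglongrightarrow> e"
    unfolding has_mean_def by blast
  have bm: "(\<lambda>y. inner y w) \<in> borel_measurable borel"
    by (intro borel_measurable_continuous_onI continuous_intros)
  have nm: "(\<lambda>\<xi>. norm (f \<xi> - s i \<xi>)) \<in> borel_measurable M" for i
  proof -
    \<comment> \<open>A difference of two measurable maps need not be measurable in a nonseparable space, but
      one of these takes only finitely many values.\<close>
    have sf: "simple_function M (s i)"
      using s[of i] by (auto elim: Bochner_Integration.simple_bochner_integrable.cases)
    have "(\<lambda>\<xi>. norm (f \<xi> - s i \<xi>)) \<in> borel_measurable M
       \<longleftrightarrow> (\<lambda>\<xi>. \<Sum>c\<in>s i ` space M. norm (f \<xi> - c) * indicator (s i -` {c} \<inter> space M) \<xi>)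
             \<in> borel_measurable M"
    proof (rule measurable_cong)
      fix \<xi> assume "\<xi> \<in> space M"
      then have "(\<Sum>c\<in>s i ` space M. norm (f \<xi> - c) * indicator (s i -` {c} \<inter> space M) \<xi>)
          = (\<Sum>c\<in>s i ` space M. if c = s i \<xi> then norm (f \<xi> - c) else 0)"
        by (intro sum.cong) (auto simp: indicator_def)
      also have "\<dots> = norm (f \<xi> - s i \<xi>)"
        using sf \<open>\<xi> \<in> space M\<close> by (simp add: simple_function_def)
      finally show "norm (f \<xi> - s i \<xi>)
          = (\<Sum>c\<in>s i ` space M. norm (f \<xi> - c) * indicator (s i -` {c} \<inter> space M) \<xi>)" ..
    qed
    moreover have "(\<lambda>\<xi>. norm (f \<xi> - c)) \<in> borel_measurable M" for c
      by (rule measurable_compose[OF f])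
        (intro borel_measurable_continuous_onI continuous_intros)
    ultimately show ?thesis
      using sf by (auto intro!: borel_measurable_sum borel_measurable_times
          borel_measurable_indicator dest: simple_functionD)
  qed
  show ?thesis
  proof (rule has_bochner_integral.intros[where s = "\<lambda>i \<xi>. inner (s i \<xi>) w"])
    show "(\<lambda>\<xi>. inner (f \<xi>) w) \<in> borel_measurable M"
      by (rule measurable_compose[OF f bm])
    show "Bochner_Integration.simple_bochner_integrable M (\<lambda>\<xi>. inner (s i \<xi>) w)" for i
      using simple_bochner_integrable_compose2[of "\<lambda>x y. inner x w", OF _ s s] by simp
    have "Bochner_Integration.simple_bochner_integral M (\<lambda>\<xi>. inner (s i \<xi>) w)
        = inner (Bochner_Integration.simple_bochner_integral M (s i)) w" for i
      by (rule simple_bochner_integral_linear[OF _ s])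
        (intro linearI; simp add: inner_add_left)
    then show "(\<lambda>i. Bochner_Integration.simple_bochner_integral M (\<lambda>\<xi>. inner (s i \<xi>) w))
        \<longlonglongrightarrow> inner e w"
      using se by (auto intro!: tendsto_intros)
    have bound: "(\<integral>\<^sup>+\<xi>. norm (inner (f \<xi>) w - inner (s i \<xi>) w) \<partial>M)
        \<le> ennreal (norm w) * (\<integral>\<^sup>+\<xi>. norm (f \<xi> - s i \<xi>) \<partial>M)" for i
    proof -
      have "(\<integral>\<^sup>+\<xi>. norm (inner (f \<xi>) w - inner (s i \<xi>) w) \<partial>M)
          \<le> (\<integral>\<^sup>+\<xi>. ennreal (norm w) * ennreal (norm (f \<xi> - s i \<xi>)) \<partial>M)"
      proof (rule nn_integral_mono)
        fix \<xi>
        have "norm (inner (f \<xi>) w - inner (s i \<xi>) w) \<le> norm w * norm (f \<xi> - s i \<xi>)"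
          using Cauchy_Schwarz_ineq2[of "f \<xi> - s i \<xi>" w]
          by (simp add: inner_diff_left mult.commute)
        then show "ennreal (norm (inner (f \<xi>) w - inner (s i \<xi>) w))
            \<le> ennreal (norm w) * ennreal (norm (f \<xi> - s i \<xi>))"
          by (simp add: ennreal_leI flip: ennreal_mult)
      qed
      also have "\<dots> = ennreal (norm w) * (\<integral>\<^sup>+\<xi>. norm (f \<xi> - s i \<xi>) \<partial>M)"
        using nm by (intro nn_integral_cmult) auto
      finally show ?thesis .
    qed
    show "(\<lambda>i. \<integral>\<^sup>+\<xi>. ennreal (norm (inner (f \<xi>) w - inner (s i \<xi>) w)) \<partial>M) \<longlonglongrightarrow> 0"
    proof (rule tendsto_sandwich[where f = "\<lambda>_. 0"])
      show "\<forall>\<^sub>F i in sequentially. (\<integral>\<^sup>+\<xi>. norm (inner (f \<xi>) w - inner (s i \<xi>) w) \<partial>M)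
          \<le> ennreal (norm w) * (\<integral>\<^sup>+\<xi>. norm (f \<xi> - s i \<xi>) \<partial>M)"
        using bound by simp
      have "(\<lambda>i. ennreal (norm w) * (\<integral>\<^sup>+\<xi>. norm (f \<xi> - s i \<xi>) \<partial>M)) \<longlonglongrightarrow> ennreal (norm w) * 0"
        by (intro ennreal_tendsto_cmult fs) simp
      then show "(\<lambda>i. ennreal (norm w) * (\<integral>\<^sup>+\<xi>. norm (f \<xi> - s i \<xi>) \<partial>M)) \<longlonglongrightarrow> 0" by simp
    qed auto
  qed
qed

lemma has_mean_unique:
  fixes f :: "'a \<Rightarrow> 'h::real_inner"
  assumes "has_mean M f e" "has_mean M f e'"
  shows "e = e'"
proof -
  have "inner e w = inner e' w" for w
    using has_bochner_integral_eq[OF has_mean_inner[OF assms(1)] has_mean_inner[OF assms(2)]] .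
  then have "inner (e - e') (e - e') = 0" by (simp add: inner_diff_left)
  then show ?thesis by simp
qed

lemma has_mean_mean:
  fixes f :: "'a \<Rightarrow> 'h::real_inner"
  assumes "mean_exists M f"
  shows "has_mean M f (mean M f)"
proof -
  obtain e where e: "has_mean M f e" using assms by (auto simp: mean_exists_def)
  then show ?thesis unfolding mean_def by (rule theI) (rule has_mean_unique[OF _ e])
qed

lemma has_bochner_integral_mean_operator_inner:
  fixes B :: "'h \<Rightarrow> 'x \<Rightarrow> 'h::real_inner"
  assumes "mean_exists M (B y)"
  shows "has_bochner_integral M (\<lambda>\<xi>. inner (B y \<xi>) w) (inner (mean_operator B M y) w)"
  using has_mean_inner[OF has_mean_mean[OF assms]] by (simp add: mean_operator_def)

text \<open>
  With \<open>D = B y \<xi> - B z \<xi>\<close> and its expectation \<open>d\<close>, the bound \<open>\<parallel>D\<parallel>\<^sup>2 \<ge> 2 \<langle>D, d\<rangle> - \<parallel>d\<parallel>\<^sup>2\<close> makes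
  the pointwise inequality affine in \<open>D\<close>, so it can be integrated by testing against vectors.
  This takes the place of Jensen's inequality for the squared norm.
\<close>

lemma mean_operator_cocoercive:
  fixes B :: "'h \<Rightarrow> 'x \<Rightarrow> 'h::real_inner"
  assumes "prob_space M" and ex: "\<And>y. mean_exists M (B y)" and th: "\<theta> > 0"
    and coco: "AE \<xi> in M. \<forall>y z.
      \<theta> * (norm (B y \<xi> - B z \<xi>))\<^sup>2 \<le> inner (B y \<xi> - B z \<xi>) (y - z)"
  shows "\<theta> * (norm (mean_operator B M y - mean_operator B M z))\<^sup>2
    \<le> inner (mean_operator B M y - mean_operator B M z) (y - z)"
proof -
  interpret prob_space M by fact
  define d where "d = mean_operator B M y - mean_operator B M z"
  have lin: "has_bochner_integral M (\<lambda>\<xi>. inner (B y \<xi> - B z \<xi>) w) (inner d w)" for w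
    unfolding d_def inner_diff_left
    by (intro has_bochner_integral_diff has_bochner_integral_mean_operator_inner ex)
  have int: "integrable M (\<lambda>\<xi>. inner (B y \<xi> - B z \<xi>) w)"
    and intval: "(\<integral>\<xi>. inner (B y \<xi> - B z \<xi>) w \<partial>M) = inner d w" for w
    using lin[of w] by (auto simp: has_bochner_integral_iff)
  have "(\<integral>\<xi>. \<theta> * (2 * inner (B y \<xi> - B z \<xi>) d - (norm d)\<^sup>2) \<partial>M)
      \<le> (\<integral>\<xi>. inner (B y \<xi> - B z \<xi>) (y - z) \<partial>M)"
  proof (rule integral_mono_AE)
    show "AE \<xi> in M. \<theta> * (2 * inner (B y \<xi> - B z \<xi>) d - (norm d)\<^sup>2)
        \<le> inner (B y \<xi> - B z \<xi>) (y - z)"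
      using coco
    proof eventually_elim
      case (elim \<xi>)
      define D where "D = B y \<xi> - B z \<xi>"
      have "0 \<le> inner (D - d) (D - d)" by simp
      then have "2 * inner D d - (norm d)\<^sup>2 \<le> (norm D)\<^sup>2"
        by (simp add: power2_norm_eq_inner inner_diff inner_commute)
      then have "\<theta> * (2 * inner D d - (norm d)\<^sup>2) \<le> \<theta> * (norm D)\<^sup>2" using th by simp
      also have "\<dots> \<le> inner D (y - z)" using elim by (simp add: D_def)
      finally show ?case by (simp add: D_def)
    qed
  qed (use int in auto)
  also have "(\<integral>\<xi>. \<theta> * (2 * inner (B y \<xi> - B z \<xi>) d - (norm d)\<^sup>2) \<partial>M)
      = \<theta> * (2 * inner d d - (norm d)\<^sup>2)"
    using int by (simp add: intval prob_space)
  finally show ?thesis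
    by (simp add: intval power2_norm_eq_inner flip: d_def)
qed

text \<open>
  For \<open>w \<noteq> 0\<close> the function \<open>\<xi> \<mapsto> \<langle>B y \<xi>, w\<rangle> / (\<beta> \<parallel>w\<parallel>)\<close> is a competitor in the supremum that
  defines the Wasserstein distance.
\<close>

lemma mean_operator_diff_le_W1:
  fixes B :: "'h \<Rightarrow> 'x::metric_space \<Rightarrow> 'h::real_inner"
  assumes exM: "mean_exists M (B y)" and exN: "mean_exists N (B y)"
    and lip: "\<beta>-lipschitz_on UNIV (B y)" and beta: "\<beta> > 0"
    and W: "W1 M N \<le> ennreal r" and r: "r \<ge> 0"
  shows "inner (mean_operator B M y - mean_operator B N y) w \<le> \<beta> * norm w * r"
proof (cases "w = 0")
  case False
  define k where "k = \<beta> * norm w"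
  have k: "k > 0" using False beta by (simp add: k_def)
  define h where "h \<xi> = inner (B y \<xi>) w / k" for \<xi>
  have hM: "has_bochner_integral M h (inner (mean_operator B M y) w / k)"
    unfolding h_def
    by (intro has_bochner_integral_divide_zero has_bochner_integral_mean_operator_inner exM)
  have hN: "has_bochner_integral N h (inner (mean_operator B N y) w / k)"
    unfolding h_def
    by (intro has_bochner_integral_divide_zero has_bochner_integral_mean_operator_inner exN)
  have "1-lipschitz_on UNIV h"
  proof (rule lipschitz_onI)
    fix \<xi> \<eta> :: 'x
    have "\<bar>inner (B y \<xi> - B y \<eta>) w\<bar> \<le> norm (B y \<xi> - B y \<eta>) * norm w"
      by (rule Cauchy_Schwarz_ineq2)
    also have "\<dots> \<le> (\<beta> * dist \<xi> \<eta>) * norm w"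
      using lipschitz_onD[OF lip, of \<xi> \<eta>] by (intro mult_right_mono) (auto simp: dist_norm)
    finally have "\<bar>inner (B y \<xi> - B y \<eta>) w\<bar> \<le> dist \<xi> \<eta> * k" by (simp add: k_def algebra_simps)
    moreover have "dist (h \<xi>) (h \<eta>) = \<bar>inner (B y \<xi> - B y \<eta>) w\<bar> / k"
      using k by (simp add: h_def dist_real_def inner_diff_left abs_divide flip: diff_divide_distrib)
    ultimately show "dist (h \<xi>) (h \<eta>) \<le> 1 * dist \<xi> \<eta>" using k by (simp add: pos_divide_le_eq)
  qed simp
  then have "ennreal \<bar>(\<integral>\<xi>. h \<xi> \<partial>M) - (\<integral>\<eta>. h \<eta> \<partial>N)\<bar> \<le> W1 M N"
    unfolding W1_def using hM hN by (intro SUP_upper) (auto simp: has_bochner_integral_iff)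
  also have "\<dots> \<le> ennreal r" by (rule W)
  finally have "\<bar>(\<integral>\<xi>. h \<xi> \<partial>M) - (\<integral>\<eta>. h \<eta> \<partial>N)\<bar> \<le> r" using r by simp
  then have "(inner (mean_operator B M y) w - inner (mean_operator B N y) w) / k \<le> r"
    using hM hN by (simp add: has_bochner_integral_iff diff_divide_distrib)
  then show ?thesis using k by (simp add: inner_diff_left k_def field_simps)
qed simp


section \<open>The solution map and its fixed point\<close>

theorem proposition2:
  fixes A :: "'h::{real_inner, complete_space} \<Rightarrow> 'h set"
    and B :: "'h \<Rightarrow> 'x::polish_space \<Rightarrow> 'h"
    and m :: "'h \<Rightarrow> 'x measure"
    and \<beta> \<theta> \<tau> \<mu>A :: real
  assumes prob: "\<And>x. prob_space (m x)"
    and borel: "\<And>x. sets (m x) = sets borel"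
    and expect: "\<And>x y. mean_exists (m x) (B y)"
    and a_max: "maximally_monotone A"
    and a_beta: "\<beta> > 0"
    and a_meas: "\<And>x. B x \<in> borel_measurable (m x)"
    and a_lip: "\<And>x. \<beta>-lipschitz_on UNIV (B x)"
    and b_theta: "\<theta> > 0"
    and b_coco: "\<And>x. AE \<xi> in m x. \<forall>y z.
                   \<theta> * (norm (B y \<xi> - B z \<xi>))\<^sup>2 \<le> inner (B y \<xi> - B z \<xi>) (y - z)"
    and c_tau: "\<tau> > 0"
    and c_wass: "\<And>x y. W1 (m x) (m y) \<le> ennreal (\<tau> * norm (x - y))"
    and d_mu: "\<mu>A > 0"
    and d_strong: "strongly_monotone \<mu>A A"
    and d_ratio: "\<beta> * \<tau> / \<mu>A < 1"
  shows "(\<forall>x. zer (add_single A (mean_operator B (m x))) = {solution_map A B m x}) \<and>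
         strict_contraction (solution_map A B m) \<and>
         (\<exists>!xbar. 0 \<in> add_single A (mean_operator B (m xbar)) xbar)"
proof -
  have coco: "\<theta> * (norm (mean_operator B (m x) y - mean_operator B (m x) z))\<^sup>2
      \<le> inner (mean_operator B (m x) y - mean_operator B (m x) z) (y - z)" for x y z
    by (rule mean_operator_cocoercive[OF prob expect b_theta b_coco])
  have mon: "0 \<le> inner (mean_operator B (m x) y - mean_operator B (m x) z) (y - z)" for x y z
    using coco[of x y z] b_theta by (smt (verit) mult_nonneg_nonneg zero_le_power2)
  define S where "S = solution_map A B m"
  have zer: "zer (add_single A (mean_operator B (m x))) = {S x}" for x
  proof -
    obtain u where u: "u \<in> zer (add_single A (mean_operator B (m x)))"
      using zer_strongly_monotone_add_cocoercive_nonempty[OF a_max d_strong d_mu b_theta coco]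
      by blast
    have "v = u" if v: "v \<in> zer (add_single A (mean_operator B (m x)))" for v
    proof -
      have "\<mu>A * (norm (v - u))\<^sup>2 \<le> 0"
        using zer_perturbation[OF d_strong mon v u] by simp
      then show ?thesis using d_mu by (simp add: mult_le_0_iff)
    qed
    then have "zer (add_single A (mean_operator B (m x))) = {u}" using u by blast
    then show ?thesis by (simp add: S_def solution_map_def)
  qed
  define L where "L = \<beta> * \<tau> / \<mu>A"
  have L: "0 \<le> L" "L < 1" using a_beta c_tau d_mu d_ratio by (auto simp: L_def)
  have lipS: "norm (S x - S y) \<le> L * norm (x - y)" for x y
  proof -
    let ?n = "norm (S x - S y)"
    have "\<mu>A * ?n\<^sup>2 \<le> inner (mean_operator B (m y) (S y) - mean_operator B (m x) (S y)) (S x - S y)"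
      by (rule zer_perturbation[OF d_strong mon]) (simp_all add: zer)
    also have "\<dots> \<le> \<beta> * ?n * (\<tau> * norm (y - x))"
      using c_tau by (intro mean_operator_diff_le_W1 expect a_lip a_beta c_wass) simp
    finally have "?n * (\<mu>A * ?n) \<le> ?n * (\<beta> * \<tau> * norm (x - y))"
      by (simp add: power2_eq_square norm_minus_commute algebra_simps)
    then have "\<mu>A * ?n \<le> \<beta> * \<tau> * norm (x - y)"
      using a_beta c_tau by (cases "?n = 0") auto
    then show ?thesis using d_mu by (simp add: L_def field_simps)
  qed
  have "L-lipschitz_on UNIV S"
    using lipS L by (intro lipschitz_onI) (auto simp: dist_norm)
  then have contr: "strict_contraction S" using L unfolding strict_contraction_def by blast
  have "\<exists>!x. S x = x"
    using lipS L by (intro banach_fix_type) (auto simp: dist_norm)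
  moreover have "0 \<in> add_single A (mean_operator B (m x)) x \<longleftrightarrow> S x = x" for x
  proof -
    have "x \<in> zer (add_single A (mean_operator B (m x))) \<longleftrightarrow> S x = x" using zer by auto
    then show ?thesis by (simp add: zer_def)
  qed
  ultimately have "\<exists>!x. 0 \<in> add_single A (mean_operator B (m x)) x" by simp
  then show ?thesis using zer contr unfolding S_def by blast
qed

end
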